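(* Let $\alpha\in[0,1)$ be Levin's binary normal number defined below, and for $N\ge 1$ let $$D_N:=\sup_{0\le a<b\le 1}\left|\frac{1}{N}\#\{0\le n<N : a\le \{2^n\alpha\}<b\}-(b-a)\right|$$ be the discrepancy of the finite sequence $(\{2^n\alpha\})_{n=0,\dots,N-1}$. Then there is a constant $c>0$ such that $$D_N\ \ge\ c\cdot\frac{(\log N)^2}{N}$$ for infinitely many $N$.
   Context: $\{x\}$ denotes the fractional part of $x$. For nonnegative integers $i,j$ let $p_{i,j}:=\binom{i+j}{j}\bmod 2\in\{0,1\}$. Levin's number $\alpha$ is defined by its binary expansion $\alpha=0.\alpha_1\alpha_2\alpha_3\ldots$, which is the concatenation $\mathcal A_1\mathcal A_2\mathcal A_3\cdots$ of finite 0-1 blocks $\mathcal A_m$ ($m=1,2,\dots$), where $\mathcal A_m$ has $2^m\cdot 2^{2^m}$ digits and is defined as follows. For an integer $n$ with $0\le n<2^{2^m}$ write $n=\sum_{j=0}^{2^m-1}e_j(n)2^j$ with $e_j(n)\in\{0,1\}$, and for $0\le k<2^m$ put $d_k(n):=\sum_{j=0}^{2^m-1}p_{k,j}e_j(n)\bmod 2$. Then $\mathcal A_m$ is the concatenation, for $n=0,1,\dots,2^{2^m}-1$ in this order, of the words $d_0(n)d_1(n)\cdots d_{2^m-1}(n)$. *)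

theory Defs
  imports "HOL-Analysis.Analysis" "HOL-Library.Stream"
begin

definition pascal_mod2 :: "nat \<Rightarrow> nat \<Rightarrow> nat" where
  "pascal_mod2 i j = ((i + j) choose j) mod 2"

definition binary_digit :: "nat \<Rightarrow> nat \<Rightarrow> nat" where
  "binary_digit j n = (n div 2 ^ j) mod 2"

definition levin_d :: "nat \<Rightarrow> nat \<Rightarrow> nat \<Rightarrow> nat" where
  "levin_d m n k = (\<Sum>j<2 ^ m. pascal_mod2 k j * binary_digit j n) mod 2"

definition levin_block :: "nat \<Rightarrow> nat list" where
  "levin_block m =
     concat (map (\<lambda>n. map (\<lambda>k. levin_d m n k) [0..<2 ^ m]) [0..<2 ^ 2 ^ m])"

text \<open>The infinite concatenation of the blocks with indices 1, 2, and so on. Streams are indexed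
  from 0, so the \<open>i\<close>-th binary digit (with \<open>i \<ge> 1\<close>) is \<open>levin_digits !! (i - 1)\<close>.\<close>

definition levin_digits :: "nat stream" where
  "levin_digits = flat (smap levin_block (fromN 1))"

definition levin_number :: real where
  "levin_number = (\<Sum>i. real (levin_digits !! i) / 2 ^ Suc i)"

definition discrepancy :: "(nat \<Rightarrow> real) \<Rightarrow> nat \<Rightarrow> real" where
  "discrepancy x N =
     (SUP (a, b) \<in> {(a, b). 0 \<le> a \<and> a < b \<and> b \<le> 1}.
        \<bar>1 / real N * real (card {n. n < N \<and> a \<le> x n \<and> x n < b}) - (b - a)\<bar>)"

text \<open>On the reals \<^const>\<open>Sup\<close> is the least upper bound only of bounded sets.\<close>

lemma bdd_above_discrepancy:
  "bdd_above ((\<lambda>(a, b). \<bar>1 / real N * real (card {n. n < N \<and> a \<le> x n \<and> x n < b}) - (b - a)\<bar>)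
     ` {(a, b). 0 \<le> a \<and> a < b \<and> b \<le> (1 :: real)})"
proof (rule bdd_aboveI2, clarify)
  fix a b :: real assume ab: "0 \<le> a" "a < b" "b \<le> 1"
  define C where "C = card {n. n < N \<and> a \<le> x n \<and> x n < b}"
  have "C \<le> card {..<N}" unfolding C_def by (rule card_mono) auto
  then have "1 / real N * real C \<le> 1" "0 \<le> 1 / real N * real C"
    by (auto simp: divide_le_eq_1)
  with ab show "\<bar>1 / real N * real (card {n. n < N \<and> a \<le> x n \<and> x n < b}) - (b - a)\<bar> \<le> 1"
    unfolding C_def by linarith
qed

text \<open>The library function \<^const>\<open>flat\<close> is the concatenation only for nonempty words; the
  next facts show that this holds here, and that the series defining the number is a genuine
  binary expansion.\<close>

lemma length_levin_block: "length (levin_block m) = 2 ^ m * 2 ^ 2 ^ m"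
  by (simp add: levin_block_def length_concat comp_def sum_list_triv)

lemma levin_block_nonempty: "levin_block m \<noteq> []"
  using length_levin_block[of m] by force

lemma flat_levin_blocks:
  "flat (smap levin_block (fromN m)) = levin_block m @- flat (smap levin_block (fromN (Suc m)))"
  using flat_unfold[of "smap levin_block (fromN m)"] by (simp add: levin_block_nonempty)

lemma levin_digit_less_2: "levin_digits !! i < 2"
proof -
  have "\<forall>xs \<in> sset (smap levin_block (fromN 1)). xs \<noteq> []"
    by (auto simp: stream.set_map levin_block_nonempty)
  then have "sset levin_digits = (\<Union>xs \<in> sset (smap levin_block (fromN 1)). set xs)"
    unfolding levin_digits_def by (rule sset_flat)
  also have "\<dots> \<subseteq> {..<2}"
    by (auto simp: stream.set_map levin_block_def levin_d_def)
  finally show ?thesis by (meson lessThan_iff snth_sset subsetD)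
qed

lemma levin_digit_0: "levin_digits !! 0 = 0"
proof -
  have "levin_digits !! 0 = hd (levin_block 1)"
    by (simp add: levin_digits_def)
  also have "\<dots> = levin_d 1 0 0"
    by (simp add: levin_block_def upt_conv_Cons)
  also have "\<dots> = 0"
    by (simp add: levin_d_def binary_digit_def)
  finally show ?thesis .
qed

lemma summable_levin: "summable (\<lambda>i. real (levin_digits !! i) / 2 ^ Suc i)"
proof (rule summable_comparison_test)
  show "\<exists>N. \<forall>i\<ge>N. norm (real (levin_digits !! i) / 2 ^ Suc i) \<le> (1 / 2) ^ Suc i"
  proof (intro exI allI impI)
    fix i
    have "real (levin_digits !! i) \<le> 1" using levin_digit_less_2[of i] by linarith
    then show "norm (real (levin_digits !! i) / 2 ^ Suc i) \<le> (1 / 2) ^ Suc i"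
      by (simp add: power_one_over divide_right_mono del: power_Suc)
  qed
  show "summable (\<lambda>i. (1 / 2 :: real) ^ Suc i)"
    using power_half_series by (rule sums_summable)
qed

lemma levin_number_bounds: "levin_number \<in> {0..<1}"
proof -
  let ?f = "\<lambda>i. real (levin_digits !! i) / 2 ^ Suc i"
  have le: "?f i \<le> (1 / 2) ^ Suc i" for i
  proof -
    have "real (levin_digits !! i) \<le> 1" using levin_digit_less_2[of i] by linarith
    then show ?thesis by (simp add: power_one_over divide_right_mono del: power_Suc)
  qed
  have sum: "summable (\<lambda>i. (1 / 2 :: real) ^ Suc i)" "(\<Sum>i. (1 / 2 :: real) ^ Suc i) = 1"
    using power_half_series by (auto simp: sums_iff)
  have "0 < (\<Sum>i. (1 / 2) ^ Suc i - ?f i)"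
    using le levin_digit_0
    by (intro suminf_pos2[where i = 0] summable_diff sum summable_levin) auto
  then have "suminf ?f < 1"
    using suminf_diff[OF sum(1) summable_levin] sum(2) by linarith
  moreover have "0 \<le> suminf ?f" by (intro suminf_nonneg summable_levin) auto
  ultimately show ?thesis by (simp add: levin_number_def)
qed

end

theory Submission
  imports Defs "HOL-Number_Theory.Cong"
begin

text \<open>
  Let \<open>q = 2 ^ m\<close> and \<open>H = q / 16\<close>. It suffices to find a segment inside the block with index \<open>m\<close> on
  which the number of visits to \<open>[0, 2/3)\<close> exceeds its expected value by a multiple of \<open>q ^ 2\<close>, because
  \<open>ln N\<close> is of order \<open>q\<close> at both ends of the segment. We take the words with index
  \<open>n < T = 4 + 4 ^ 2 + \<dots> + 4 ^ (H - 1)\<close> and cut \<open>[0, T)\<close> into one aligned interval of length \<open>2 ^ j\<close> for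
  each \<open>j = 2 i\<close>, \<open>1 \<le> i < H\<close>.

  Fix \<open>j\<close> and an offset \<open>k < q\<close> inside the words. Any \<open>j\<close> consecutive rows of the Pascal matrix modulo 2
  are nonsingular on the first \<open>j\<close> columns, so the first \<open>j\<close> digits read from offset \<open>k\<close> run through all
  words of length \<open>j\<close> once. Since \<open>2/3 = 0.1010\<dots>\<close> in base 2, the excess is at least \<open>1/3\<close> when the one
  word \<open>1010\<dots>10\<close> is followed by the digit 0, and at least \<open>-2/3\<close> otherwise. Taking \<open>j\<close>-th differences
  of \<open>k \<mapsto> d\<^sub>k(n)\<close> shows that this digit is 0 if and only if the binomial coefficient
  \<open>k div 2 + H\<close> over \<open>H - 1 - i\<close> is even, which by Lucas fails only for a proportion of order \<open>(3/4) ^ log 2 H\<close> of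
  the pairs \<open>(k, i)\<close>. When the digits extend into the next word (\<open>k + j \<ge> q\<close>) the excess is still
  bounded below by a constant, and there are few such pairs as \<open>j < q / 8\<close>.
\<close>

subsection \<open>Binomial coefficients modulo 2\<close>

lemma cong_2_nat_iff: "[a = b] (mod 2) \<longleftrightarrow> (even a \<longleftrightarrow> even (b :: nat))"
  unfolding cong_def even_iff_mod_2_eq_zero by linarith

text \<open>By the absorption identity \<open>2 ^ m\<close> divides
  \<open>l * (2 ^ m choose l)\<close>, so an odd coefficient would force \<open>2 ^ m\<close> to
  divide \<open>l\<close>.\<close>

lemma even_choose_power_two:
  assumes "0 < l" "l < 2 ^ m"
  shows "even (2 ^ m choose l)"
proof (rule ccontr)
  assume "odd (2 ^ m choose l)"
  then have "coprime (2 ^ m) (2 ^ m choose l)" by simp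
  moreover have "2 ^ m dvd l * (2 ^ m choose l)"
    using times_binomial_minus1_eq[OF assms(1), of "2 ^ m"] by simp
  ultimately have "2 ^ m dvd l" using coprime_dvd_mult_left_iff by blast
  with assms show False using dvd_imp_le by fastforce
qed

text \<open>In the Vandermonde expansion only the term \<open>k = 0\<close> is odd-relevant, the
  others having an even factor. This gives the Pascal matrix its row period \<open>2 ^ m\<close> on
  the first \<open>2 ^ m\<close> columns.\<close>

lemma choose_power_two_add_cong:
  assumes "i < 2 ^ m"
  shows "[(2 ^ m + y) choose i = y choose i] (mod 2)"
proof -
  have "(2 ^ m + y) choose i = (\<Sum>k\<le>i. (2 ^ m choose k) * (y choose (i - k)))"
    by (rule vandermonde[symmetric])
  also have "[\<dots> = (\<Sum>k\<le>i. if k = 0 then y choose i else 0)] (mod 2)"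
  proof (rule cong_sum)
    fix k assume "k \<in> {..i}"
    then show "[(2 ^ m choose k) * (y choose (i - k)) = (if k = 0 then y choose i else 0)] (mod 2)"
      using even_choose_power_two[of k m] assms by (auto simp: cong_0_iff)
  qed
  finally show ?thesis by simp
qed

text \<open>Lucas' theorem for the lowest binary digit. The two clauses with even top feed each
  other when Pascal's rule is applied twice, so they share one induction; one more use of the rule
  gives odd tops.\<close>

lemma choose_double_cong:
  "[(2 * a) choose (2 * b) = a choose b] (mod 2)"
  "[Suc (2 * a) choose (2 * b) = a choose b] (mod 2)"
  "even ((2 * a) choose Suc (2 * b))"
  "[Suc (2 * a) choose Suc (2 * b) = a choose b] (mod 2)"
proof -
  have "[(2 * a) choose (2 * b) = a choose b] (mod 2) \<and> even ((2 * a) choose Suc (2 * b))" for b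
  proof (induction a arbitrary: b)
    case 0
    then show ?case by (cases b) auto
  next
    case (Suc a)
    have s: "2 * Suc a = Suc (Suc (2 * a))" for a by simp
    have even_case: "[(2 * Suc a) choose (2 * b) = Suc a choose b] (mod 2)"
    proof (cases b)
      case (Suc c)
      have "even ((2 * a) choose Suc (2 * c))" "[(2 * a) choose (2 * c) = a choose c] (mod 2)"
        "[(2 * a) choose (2 * Suc c) = a choose Suc c] (mod 2)"
        using Suc.IH by blast+
      then show ?thesis unfolding Suc s by (auto simp: cong_2_nat_iff)
    qed auto
    have "even ((2 * Suc a) choose Suc (2 * b))"
    proof (cases b)
      case (Suc c)
      have "even ((2 * a) choose Suc (2 * c))" "even ((2 * a) choose Suc (2 * Suc c))"
        "[(2 * a) choose (2 * Suc c) = a choose Suc c] (mod 2)" using Suc.IH by blast+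
      then show ?thesis unfolding Suc s by (auto simp: cong_2_nat_iff)
    qed auto
    with even_case show ?case by blast
  qed
  note ih = this
  show "[(2 * a) choose (2 * b) = a choose b] (mod 2)" "even ((2 * a) choose Suc (2 * b))"
    using ih by blast+
  show "[Suc (2 * a) choose Suc (2 * b) = a choose b] (mod 2)"
    using ih[of b] by (auto simp: cong_2_nat_iff)
  show "[Suc (2 * a) choose (2 * b) = a choose b] (mod 2)"
  proof (cases b)
    case (Suc c)
    then show ?thesis using ih[of b] ih[of c] by (auto simp: cong_2_nat_iff)
  qed simp
qed

lemma choose_halves_cong: "[x choose (2 * b) = (x div 2) choose b] (mod 2)"
  using choose_double_cong(1,2)[of "x div 2" b] by (cases "even x") auto

text \<open>By Lucas three of the four pairs of lowest bits preserve oddness, hence a factor 3 per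
  bit. The \<open>b\<close> bits of \<open>x\<close> beyond the range of \<open>r\<close> are
  free.\<close>

lemma card_odd_choose:
  "card {(x, r). x < 2 ^ (b + a) \<and> r < 2 ^ a \<and> odd (x choose r)} = 2 ^ b * 3 ^ a"
proof (induction a)
  case 0
  have "{(x, r). x < 2 ^ (b + 0) \<and> r < 2 ^ 0 \<and> odd (x choose r)} = {..<2 ^ b} \<times> {0::nat}"
    by auto
  then show ?case by (simp add: card_cartesian_product)
next
  case (Suc a)
  let ?A = "\<lambda>a. {(x, r). x < 2 ^ (b + a) \<and> r < 2 ^ a \<and> odd (x choose r)}"
  let ?f = "\<lambda>(x, r). (2 * x, 2 * r)" and ?g = "\<lambda>(x, r). (Suc (2 * x), 2 * r)"
    and ?h = "\<lambda>(x, r). (Suc (2 * x), Suc (2 * r))"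
  have fin: "finite (?A a)"
    by (rule finite_subset[of _ "{..<2 ^ (b + a)} \<times> {..<2 ^ a}"]) auto
  have par: "odd ((2 * x) choose (2 * r)) \<longleftrightarrow> odd (x choose r)"
    "odd (Suc (2 * x) choose (2 * r)) \<longleftrightarrow> odd (x choose r)"
    "odd (Suc (2 * x) choose Suc (2 * r)) \<longleftrightarrow> odd (x choose r)"
    "even ((2 * x) choose Suc (2 * r))" for x r
    using choose_double_cong[of x r] by (auto simp: cong_2_nat_iff)
  have "?A (Suc a) = ?f ` ?A a \<union> (?g ` ?A a \<union> ?h ` ?A a)" (is "?L = ?R")
  proof
    show "?R \<subseteq> ?L" using par by (auto simp del: binomial_Suc_Suc)
    show "?L \<subseteq> ?R"
    proof
      fix p assume p: "p \<in> ?L"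
      obtain y s where ys: "p = (y, s)" by fastforce
      obtain x where x: "y = 2 * x \<or> y = Suc (2 * x)" by (metis oddE Suc_eq_plus1 evenE)
      obtain r where r: "s = 2 * r \<or> s = Suc (2 * r)" by (metis oddE Suc_eq_plus1 evenE)
      have "(x, r) \<in> ?A a"
        using p ys x r par[of x r] by (auto simp del: binomial_Suc_Suc)
      moreover have "p = ?f (x, r) \<or> p = ?g (x, r) \<or> p = ?h (x, r)"
        using p ys x r par[of x r] by (auto simp del: binomial_Suc_Suc)
      ultimately show "p \<in> ?R" by blast
    qed
  qed
  moreover have "?f ` ?A a \<inter> (?g ` ?A a \<union> ?h ` ?A a) = {}" "?g ` ?A a \<inter> ?h ` ?A a = {}"
    by (auto simp: image_iff) presburger+
  moreover have "card (?f ` ?A a) = card (?A a)" "card (?g ` ?A a) = card (?A a)"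
    "card (?h ` ?A a) = card (?A a)"
    by (rule card_image, auto simp: inj_on_def)+
  ultimately have "card (?A (Suc a)) = 3 * card (?A a)"
    using fin by (simp add: card_Un_disjoint)
  with Suc.IH show ?case by simp
qed

section \<open>Iterated differences modulo 2\<close>

lemma binomial_transform_Suc:
  fixes f :: "nat \<Rightarrow> nat"
  shows "(\<Sum>i\<le>Suc s. (Suc s choose i) * f i)
    = (\<Sum>i\<le>s. (s choose i) * f i) + (\<Sum>i\<le>s. (s choose i) * f (Suc i))"
proof -
  have "(\<Sum>i\<le>Suc s. (Suc s choose i) * f i)
    = f 0 + (\<Sum>i\<le>s. (Suc s choose Suc i) * f (Suc i))"
    by (subst sum.atMost_Suc_shift) simp
  also have "\<dots> = f 0 + (\<Sum>i\<le>s. (s choose Suc i) * f (Suc i)) + (\<Sum>i\<le>s. (s choose i) * f (Suc i))"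
    by (simp add: algebra_simps sum.distrib)
  also have "f 0 + (\<Sum>i\<le>s. (s choose Suc i) * f (Suc i)) = (\<Sum>i\<le>Suc s. (s choose i) * f i)"
    by (subst sum.atMost_Suc_shift) simp
  finally show ?thesis by simp
qed

text \<open>Modulo 2 the binomial transform is the iterated difference operator, which lowers the lower
  index of a binomial coefficient.\<close>

lemma binomial_transform_choose_cong:
  "[(\<Sum>i\<le>s. (s choose i) * ((k + i + l) choose l)) = (if s \<le> l then (k + l) choose (l - s) else 0)] (mod 2)"
proof (induction s arbitrary: k)
  case (Suc s)
  have "(\<Sum>i\<le>Suc s. (Suc s choose i) * ((k + i + l) choose l))
    = (\<Sum>i\<le>s. (s choose i) * ((k + i + l) choose l))
      + (\<Sum>i\<le>s. (s choose i) * ((Suc k + i + l) choose l))"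
    by (subst binomial_transform_Suc) simp
  also have "[\<dots> = (if s \<le> l then (k + l) choose (l - s) else 0)
      + (if s \<le> l then (Suc k + l) choose (l - s) else 0)] (mod 2)"
    by (intro cong_add Suc.IH)
  \<comment> \<open>For \<open>s < l\<close> Pascal's rule leaves twice a coefficient plus the next
    lower one; for \<open>s = l\<close> the sum is 1 + 1.\<close>
  also have "[(if s \<le> l then (k + l) choose (l - s) else 0)
      + (if s \<le> l then (Suc k + l) choose (l - s) else 0)
      = (if Suc s \<le> l then (k + l) choose (l - Suc s) else 0)] (mod 2)"
  proof (cases "s < l")
    case True
    then obtain d where "l = Suc (s + d)" using less_iff_Suc_add by auto
    then show ?thesis by (auto simp: cong_2_nat_iff)
  qed (auto simp: cong_2_nat_iff)
  finally show ?case .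
qed (simp add: cong_def)

text \<open>The \<open>s\<close>-th difference annihilates the columns below \<open>s\<close> and
  lowers the others. It serves twice: to isolate a single coefficient, and to compute the digit that
  follows a known word.\<close>

lemma binomial_transform_newton_cong:
  fixes e :: "nat \<Rightarrow> nat"
  shows "[(\<Sum>i\<le>s. (s choose i) * (\<Sum>l<L. e l * ((k + i + l) choose l)))
    = (\<Sum>l\<in>{s..<L}. e l * ((k + l) choose (l - s)))] (mod 2)"
proof -
  have "(\<Sum>i\<le>s. (s choose i) * (\<Sum>l<L. e l * ((k + i + l) choose l)))
    = (\<Sum>i\<le>s. \<Sum>l<L. (s choose i) * (e l * ((k + i + l) choose l)))"
    by (simp add: sum_distrib_left)
  also have "\<dots> = (\<Sum>l<L. \<Sum>i\<le>s. (s choose i) * (e l * ((k + i + l) choose l)))"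
    by (rule sum.swap)
  also have "\<dots> = (\<Sum>l<L. e l * (\<Sum>i\<le>s. (s choose i) * ((k + i + l) choose l)))"
    by (simp add: sum_distrib_left mult.left_commute)
  also have "[\<dots> = (\<Sum>l<L. e l * (if s \<le> l then (k + l) choose (l - s) else 0))] (mod 2)"
    by (intro cong_sum cong_mult cong_refl binomial_transform_choose_cong)
  also have "(\<Sum>l<L. e l * (if s \<le> l then (k + l) choose (l - s) else 0))
    = (\<Sum>l\<in>{s..<L}. e l * ((k + l) choose (l - s)))"
    by (rule sum.mono_neutral_cong_right) auto
  finally show ?thesis .
qed

text \<open>Nonsingularity of \<open>L\<close> consecutive rows on the first \<open>L\<close>
  columns. Descending in \<open>l\<close>, the \<open>l\<close>-th difference is \<open>e l\<close>
  plus terms with higher coefficients, which are already known to be even.\<close>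

lemma newton_parity_unique:
  fixes e :: "nat \<Rightarrow> nat"
  assumes zero: "\<And>i. i < L \<Longrightarrow> even (\<Sum>l<L. e l * ((k + i + l) choose l))"
    and "l < L"
  shows "even (e l)"
  using \<open>l < L\<close>
proof (induction "L - l" arbitrary: l rule: less_induct)
  case less
  have "even (\<Sum>i\<le>l. (l choose i) * (\<Sum>r<L. e r * ((k + i + r) choose r)))"
    by (intro dvd_sum dvd_mult zero) (use less.prems in auto)
  then have "even (\<Sum>r\<in>{l..<L}. e r * ((k + r) choose (r - l)))"
    using binomial_transform_newton_cong[of l e k L] by (simp add: cong_dvd_iff)
  also have "{l..<L} = insert l {l<..<L}" using less.prems by auto
  finally have "even (e l + (\<Sum>r\<in>{l<..<L}. e r * ((k + r) choose (r - l))))" by simp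
  moreover have "even (\<Sum>r\<in>{l<..<L}. e r * ((k + r) choose (r - l)))"
    by (intro dvd_sum dvd_mult2 less.hyps) (auto intro: diff_less_mono2)
  ultimately show ?case by simp
qed

subsection \<open>Windows of rows of the Pascal matrix\<close>

lemma levin_d_less_2 [simp]: "levin_d m n k < 2"
  by (simp add: levin_d_def)

lemma levin_d_cong:
  "[levin_d m n x = (\<Sum>l<2 ^ m. binary_digit l n * ((x + l) choose l))] (mod 2)"
proof -
  have "[levin_d m n x = (\<Sum>l<2 ^ m. pascal_mod2 x l * binary_digit l n)] (mod 2)"
    by (simp add: levin_d_def cong_def)
  also have "[(\<Sum>l<2 ^ m. pascal_mod2 x l * binary_digit l n)
      = (\<Sum>l<2 ^ m. ((x + l) choose l) * binary_digit l n)] (mod 2)"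
    by (intro cong_sum cong_mult) (auto simp: pascal_mod2_def cong_def)
  finally show ?thesis by (simp add: mult.commute)
qed

lemma levin_d_eq_iff:
  "levin_d m n x = levin_d m n' x \<longleftrightarrow>
    even (\<Sum>l<2 ^ m. (binary_digit l n + binary_digit l n') * ((x + l) choose l))"
proof -
  have "even (\<Sum>l<2 ^ m. (binary_digit l n + binary_digit l n') * ((x + l) choose l))
    \<longleftrightarrow> even (levin_d m n x + levin_d m n' x)"
    using levin_d_cong[of m n x] levin_d_cong[of m n' x]
    by (simp add: cong_2_nat_iff distrib_right sum.distrib)
  also have "\<dots> \<longleftrightarrow> levin_d m n x = levin_d m n' x"
    using levin_d_less_2[of m n x] levin_d_less_2[of m n' x]
    by (auto simp: less_2_cases_iff)
  finally show ?thesis by simp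
qed

text \<open>Allows digits of the following word to be addressed by unreduced offsets
  \<open>k + i\<close> beyond the end of the current one.\<close>

lemma levin_d_periodic: "levin_d m n (2 ^ m + x) = levin_d m n x"
proof -
  have "(\<Sum>l<2 ^ m. pascal_mod2 (2 ^ m + x) l * binary_digit l n)
    = (\<Sum>l<2 ^ m. pascal_mod2 x l * binary_digit l n)"
  proof (rule sum.cong[OF refl])
    fix l :: nat assume "l \<in> {..<2 ^ m}"
    then show "pascal_mod2 (2 ^ m + x) l * binary_digit l n = pascal_mod2 x l * binary_digit l n"
      using choose_power_two_add_cong[of l m "x + l"] by (simp add: pascal_mod2_def cong_def add.assoc)
  qed
  then show ?thesis by (simp add: levin_d_def)
qed

lemma even_binary_digit_add_iff:
  "even (binary_digit l n + binary_digit l n') \<longleftrightarrow> binary_digit l n = binary_digit l n'"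
proof -
  have "even (a mod 2 + b mod 2) \<longleftrightarrow> a mod 2 = b mod (2 :: nat)" for a b
    by presburger
  then show ?thesis by (simp add: binary_digit_def)
qed

lemma mod_power_two_eqI:
  assumes "\<And>l. l < a \<Longrightarrow> binary_digit l n = binary_digit l n'"
  shows "n mod 2 ^ a = n' mod 2 ^ a"
proof -
  have "bit n l = bit n' l" if "l < a" for l
    using assms[OF that] by (simp add: bit_iff_odd binary_digit_def odd_iff_mod_2_eq_one)
  then have "take_bit a n = take_bit a n'"
    by (intro bit_eqI) (auto simp: bit_take_bit_iff)
  then show ?thesis by (simp add: take_bit_eq_mod)
qed

lemma binary_digit_add: "binary_digit (j + l) n = binary_digit l (n div 2 ^ j)"
  by (simp add: binary_digit_def power_add div_mult2_eq)

lemma binary_digit_mod: "l < a \<Longrightarrow> binary_digit l (n mod 2 ^ a) = binary_digit l n"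
  using bit_take_bit_iff[of a n l]
  by (simp add: binary_digit_def bit_iff_odd take_bit_eq_mod mod2_eq_if)

text \<open>Binary digits from position \<open>j\<close> on agree, so modulo 2 they cancel from the
  comparison, which leaves the nonsingular system of \<open>j\<close> rows and \<open>j\<close>
  columns.\<close>

lemma levin_d_window_inj:
  assumes j: "j \<le> 2 ^ m" and div: "n div 2 ^ j = n' div 2 ^ j"
    and eq: "\<And>i. i < j \<Longrightarrow> levin_d m n (k + i) = levin_d m n' (k + i)"
  shows "n = n'"
proof -
  let ?e = "\<lambda>l. binary_digit l n + binary_digit l n'"
  have high: "even (?e l)" if "j \<le> l" for l
    unfolding even_binary_digit_add_iff
    using binary_digit_add[of j "l - j" n] binary_digit_add[of j "l - j" n'] that div by simp
  have "even (\<Sum>l<j. ?e l * ((k + i + l) choose l))" if "i < j" for i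
  proof -
    have "(\<Sum>l<2 ^ m. ?e l * ((k + i + l) choose l))
      = (\<Sum>l<j. ?e l * ((k + i + l) choose l)) + (\<Sum>l\<in>{j..<2 ^ m}. ?e l * ((k + i + l) choose l))"
      using sum.atLeastLessThan_concat[OF le0 j, symmetric] by (simp only: atLeast0LessThan)
    moreover have "even (\<Sum>l\<in>{j..<2 ^ m}. ?e l * ((k + i + l) choose l))"
      by (intro dvd_sum dvd_mult2 high) auto
    moreover have "even (\<Sum>l<2 ^ m. ?e l * ((k + i + l) choose l))"
      using eq[OF that] levin_d_eq_iff by blast
    ultimately show ?thesis by (simp only: even_add)
  qed
  then have "even (?e l)" if "l < j" for l
    using newton_parity_unique[of j ?e k l] that by blast
  then have "n mod 2 ^ j = n' mod 2 ^ j"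
    by (intro mod_power_two_eqI) (simp only: even_binary_digit_add_iff)
  with div show ?thesis by (metis div_mult_mod_eq)
qed

text \<open>The last \<open>a\<close> rows of the Pascal matrix modulo 2 vanish outside of the first \<open>a\<close> columns.\<close>

lemma even_choose_last_rows:
  assumes "i < a" "a \<le> l" "l < 2 ^ m"
  shows "even ((2 ^ m - a + i + l) choose l)"
proof -
  \<comment> \<open>After removal of the period \<open>2 ^ m\<close> the top index is
    \<open>i + l - a\<close>, which is smaller than \<open>l\<close>.\<close>
  have eq: "2 ^ m - a + i + l = 2 ^ m + (i + l - a)" using assms by linarith
  have "[(2 ^ m + (i + l - a)) choose l = (i + l - a) choose l] (mod 2)"
    by (rule choose_power_two_add_cong) (rule assms)
  moreover have "(i + l - a) choose l = 0" using assms by (intro binomial_eq_0) linarith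
  ultimately show ?thesis unfolding eq by (simp add: cong_2_nat_iff)
qed

lemma levin_d_last_rows:
  assumes a: "a \<le> 2 ^ m"
  shows "(\<forall>i<a. levin_d m n (2 ^ m - a + i) = levin_d m n' (2 ^ m - a + i))
    \<longleftrightarrow> n mod 2 ^ a = n' mod 2 ^ a"
proof -
  let ?e = "\<lambda>l. binary_digit l n + binary_digit l n'"
  let ?k = "2 ^ m - a"
  have iff: "levin_d m n (?k + i) = levin_d m n' (?k + i) \<longleftrightarrow>
      even (\<Sum>l<a. ?e l * ((?k + i + l) choose l))" if "i < a" for i
  proof -
    have "(\<Sum>l<2 ^ m. ?e l * ((?k + i + l) choose l))
      = (\<Sum>l<a. ?e l * ((?k + i + l) choose l)) + (\<Sum>l\<in>{a..<2 ^ m}. ?e l * ((?k + i + l) choose l))"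
      using sum.atLeastLessThan_concat[OF le0 a, symmetric] by (simp only: atLeast0LessThan)
    moreover have "even (\<Sum>l\<in>{a..<2 ^ m}. ?e l * ((?k + i + l) choose l))"
      by (intro dvd_sum dvd_mult even_choose_last_rows) (use that in auto)
    ultimately show ?thesis unfolding levin_d_eq_iff by simp
  qed
  show ?thesis
  proof
    assume "\<forall>i<a. levin_d m n (?k + i) = levin_d m n' (?k + i)"
    then have "even (?e l)" if "l < a" for l
      using newton_parity_unique[of a ?e ?k l] that iff by blast
    then show "n mod 2 ^ a = n' mod 2 ^ a"
      by (intro mod_power_two_eqI) (simp only: even_binary_digit_add_iff)
  next
    assume "n mod 2 ^ a = n' mod 2 ^ a"
    then have "even (?e l)" if "l < a" for l
      unfolding even_binary_digit_add_iff
      using that binary_digit_mod[of l a n] binary_digit_mod[of l a n'] by simp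
    then show "\<forall>i<a. levin_d m n (?k + i) = levin_d m n' (?k + i)"
      by (auto simp: iff intro!: dvd_sum dvd_mult2)
  qed
qed

text \<open>The successor, taken cyclically inside the aligned block of length \<open>2 ^ j\<close>. A window that wraps
  into the next word then depends injectively on \<open>n\<close>, at the price of one wrong index per block.\<close>

definition block_succ :: "nat \<Rightarrow> nat \<Rightarrow> nat" where
  "block_succ j n = (if Suc n div 2 ^ j = n div 2 ^ j then Suc n else n div 2 ^ j * 2 ^ j)"

lemma block_succ_cases:
  assumes "block_succ j n \<noteq> Suc n"
  shows "Suc n = Suc (n div 2 ^ j) * 2 ^ j"
proof -
  have "Suc n div 2 ^ j \<noteq> n div 2 ^ j" using assms by (auto simp: block_succ_def)
  then have "Suc n mod 2 ^ j = 0" "Suc n div 2 ^ j = Suc (n div 2 ^ j)"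
    by (auto simp: div_Suc split: if_splits)
  then show ?thesis by (metis div_mult_mod_eq add.right_neutral)
qed

lemma block_succ_div [simp]: "block_succ j n div 2 ^ j = n div 2 ^ j"
  by (auto simp: block_succ_def)

lemma block_succ_mod: "a \<le> j \<Longrightarrow> block_succ j n mod 2 ^ a = Suc n mod 2 ^ a"
proof (cases "block_succ j n = Suc n")
  case False
  assume "a \<le> j"
  then have d: "(2::nat) ^ a dvd 2 ^ j" by (rule le_imp_power_dvd)
  have "block_succ j n = n div 2 ^ j * 2 ^ j" using False by (auto simp: block_succ_def)
  then have "block_succ j n mod 2 ^ a = 0" using d by simp
  moreover have "Suc n mod 2 ^ a = 0" using block_succ_cases[OF False] d
    by (metis dvd_imp_mod_0 dvd_mult)
  ultimately show ?thesis by simp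
qed simp

lemma block_succ_inj:
  assumes "n div 2 ^ j = n' div 2 ^ j" "block_succ j n = block_succ j n'"
  shows "n = n'"
proof -
  have "Suc n mod 2 ^ j = Suc n' mod 2 ^ j"
    using block_succ_mod[of j j n] block_succ_mod[of j j n'] assms by simp
  then have "n mod 2 ^ j = n' mod 2 ^ j"
    using cong_add_rcancel_nat[of n 1 n' "2 ^ j"] by (simp add: cong_def)
  with assms(1) show ?thesis by (metis div_mult_mod_eq)
qed

definition block_word :: "nat \<Rightarrow> nat \<Rightarrow> nat \<Rightarrow> nat \<Rightarrow> nat \<Rightarrow> nat" where
  "block_word m j k n i =
     (if k + i < 2 ^ m then levin_d m n (k + i) else levin_d m (block_succ j n) (k + i))"

text \<open>If the window wraps, its first \<open>a = 2 ^ m - k\<close> digits are the last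
  \<open>a\<close> rows and fix \<open>n\<close> modulo \<open>2 ^ a\<close>. Hence they fix the
  cyclic successor modulo \<open>2 ^ a\<close> and with it the successor's own digits in these rows.
  Now all \<open>j\<close> rows of the window are known for the successor.\<close>

lemma block_word_inj:
  assumes j: "j \<le> 2 ^ m" and k: "k < 2 ^ m" and div: "n div 2 ^ j = n' div 2 ^ j"
    and eq: "\<And>i. i < j \<Longrightarrow> block_word m j k n i = block_word m j k n' i"
  shows "n = n'"
proof (cases "k + j \<le> 2 ^ m")
  case True
  show ?thesis
  proof (rule levin_d_window_inj[OF j div])
    fix i assume "i < j"
    with True eq[of i] show "levin_d m n (k + i) = levin_d m n' (k + i)"
      by (simp add: block_word_def)
  qed
next
  case False
  define a where "a = 2 ^ m - k"
  have a: "a < j" "a \<le> 2 ^ m" and ka: "2 ^ m - a = k"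
    using False k unfolding a_def by linarith+
  have "levin_d m n (k + i) = levin_d m n' (k + i)" if "i < a" for i
    using that a eq[of i] by (simp add: block_word_def a_def less_diff_conv add.commute)
  then have "n mod 2 ^ a = n' mod 2 ^ a" using levin_d_last_rows[OF a(2)] unfolding ka by blast
  then have "Suc n mod 2 ^ a = Suc n' mod 2 ^ a" by (metis mod_Suc_eq)
  then have "block_succ j n mod 2 ^ a = block_succ j n' mod 2 ^ a"
    using a by (simp add: block_succ_mod)
  then have low: "\<forall>i<a. levin_d m (block_succ j n) (k + i) = levin_d m (block_succ j n') (k + i)"
    using levin_d_last_rows[OF a(2)] unfolding ka by blast
  have "block_succ j n = block_succ j n'"
  proof (rule levin_d_window_inj[OF j])
    show "block_succ j n div 2 ^ j = block_succ j n' div 2 ^ j" using div by simp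
    fix i assume i: "i < j"
    show "levin_d m (block_succ j n) (k + i) = levin_d m (block_succ j n') (k + i)"
    proof (cases "i < a")
      case False
      then have "\<not> k + i < 2 ^ m" unfolding a_def by linarith
      with eq[OF i] show ?thesis by (simp add: block_word_def)
    qed (use low in blast)
  qed
  with div show ?thesis by (rule block_succ_inj)
qed

section \<open>Digits of the endpoint T and the digit after the alternating word\<close>

primrec power4_sum :: "nat \<Rightarrow> nat" where
  "power4_sum 0 = 0"
| "power4_sum (Suc K) = 4 * Suc (power4_sum K)"

lemma four_dvd_power4_sum: "4 dvd power4_sum K"
  by (cases K) auto

lemma binary_digit_power4_sum:
  "binary_digit l (power4_sum K) = of_bool (even l \<and> 1 \<le> l div 2 \<and> l div 2 \<le> K)"
proof (induction K arbitrary: l)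
  case 0
  then show ?case by (simp add: binary_digit_def)
next
  case (Suc K)
  have "l = 0 \<or> l = 1 \<or> l = 2 \<or> (\<exists>t. l = 3 + t)" by presburger
  then consider "l = 0" | "l = 1" | "l = 2" | t where "l = 3 + t" by blast
  then show ?case
  proof cases
    case 1
    then show ?thesis by (simp add: binary_digit_def)
  next
    case 2
    then show ?thesis by (simp add: binary_digit_def)
  next
    case 3
    have "binary_digit 2 (power4_sum (Suc K)) = Suc (power4_sum K) mod 2"
      by (simp add: binary_digit_def)
    also have "\<dots> = 1" using four_dvd_power4_sum[of K] by presburger
    finally show ?thesis using 3 by simp
  next
    \<comment> \<open>With \<open>S = power4_sum K\<close> even,
      \<open>4 * Suc S div 8 = S div 2\<close>. A shift by only two places would still show the
      added 1.\<close>
    case (4 t)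
    have "binary_digit (3 + t) (power4_sum (Suc K)) = binary_digit t (power4_sum (Suc K) div 2 ^ 3)"
      by (rule binary_digit_add)
    also have "power4_sum (Suc K) div 2 ^ 3 = power4_sum K div 2 ^ 1"
      using four_dvd_power4_sum[of K] by simp presburger
    also have "binary_digit t \<dots> = binary_digit (1 + t) (power4_sum K)"
      by (rule binary_digit_add[symmetric])
    also have "\<dots> = of_bool (even l \<and> 1 \<le> l div 2 \<and> l div 2 \<le> Suc K)"
    proof (cases "even l")
      case True
      then have "odd t" using 4 by simp
      then obtain u where "t = 2 * u + 1" by (auto elim: oddE)
      then have "l = 2 * (u + 2)" "1 + t = 2 * (u + 1)" using 4 by simp_all
      then show ?thesis by (simp only: Suc.IH) simp
    next
      case False
      then have "odd (1 + t)" using 4 by simp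
      then show ?thesis using False Suc.IH[of "1 + t"] by simp
    qed
    finally show ?thesis using 4 by simp
  qed
qed

lemma sum_power4_sum_digits:
  fixes g :: "nat \<Rightarrow> nat"
  assumes "2 * K < L"
  shows "(\<Sum>l<L. binary_digit l (power4_sum K) * g l) = (\<Sum>r=1..K. g (2 * r))"
proof -
  have "(\<Sum>l<L. binary_digit l (power4_sum K) * g l)
    = (\<Sum>l\<in>(\<lambda>r. 2 * r) ` {1..K}. binary_digit l (power4_sum K) * g l)"
  proof (rule sum.mono_neutral_right)
    show "(\<lambda>r. 2 * r) ` {1..K} \<subseteq> {..<L}" using assms by auto
    show "\<forall>l\<in>{..<L} - (\<lambda>r. 2 * r) ` {1..K}. binary_digit l (power4_sum K) * g l = 0"
    proof
      fix l assume l: "l \<in> {..<L} - (\<lambda>r. 2 * r) ` {1..K}"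
      have "\<not> (even l \<and> 1 \<le> l div 2 \<and> l div 2 \<le> K)"
      proof
        assume "even l \<and> 1 \<le> l div 2 \<and> l div 2 \<le> K"
        then have "l = 2 * (l div 2)" "l div 2 \<in> {1..K}" by auto
        then have "l \<in> (\<lambda>r. 2 * r) ` {1..K}" by (rule image_eqI)
        with l show False by simp
      qed
      then show "binary_digit l (power4_sum K) * g l = 0"
        unfolding binary_digit_power4_sum by simp
    qed
  qed simp
  also have "\<dots> = (\<Sum>r=1..K. binary_digit (2 * r) (power4_sum K) * g (2 * r))"
    by (subst sum.reindex) (auto simp: inj_on_def)
  also have "\<dots> = (\<Sum>r=1..K. g (2 * r))"
    by (rule sum.cong) (auto simp: binary_digit_power4_sum)
  finally show ?thesis .
qed

text \<open>Including \<open>i = j\<close> the sum is \<open>2 ^ (j - 1)\<close>, which is even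
  since \<open>j \<ge> 2\<close>. This is the contribution of the word 1010...10 to a
  \<open>j\<close>-th difference.\<close>

lemma odd_choose_even_indices:
  assumes "j > 0" "even j"
  shows "odd (\<Sum>i<j. (j choose i) * of_bool (even i))"
proof -
  have "int (\<Sum>i\<le>j. (j choose i) * of_bool (even i)) = (\<Sum>i\<le>j. if even i then of_nat (j choose i) else 0)"
    unfolding of_nat_sum by (rule sum.cong) auto
  then have "2 * int (\<Sum>i\<le>j. (j choose i) * of_bool (even i)) = 2 ^ j"
    using choose_even_sum[OF assms(1), where 'a = int] by simp
  moreover obtain t where t: "j = Suc (Suc t)"
  proof (cases j)
    case (Suc u)
    then show ?thesis using that assms by (cases u) auto
  qed (use assms in simp)
  ultimately have "int (\<Sum>i\<le>j. (j choose i) * of_bool (even i)) = 2 * 2 ^ t" by simp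
  then have "even (\<Sum>i\<le>j. (j choose i) * of_bool (even i))"
    by (metis dvd_triv_left even_of_nat_iff)
  moreover have "(\<Sum>i\<le>j. (j choose i) * of_bool (even i))
    = (\<Sum>i<j. (j choose i) * of_bool (even i)) + 1"
    using assms by (simp add: lessThan_Suc_atMost[symmetric])
  ultimately show ?thesis by simp
qed

text \<open>The \<open>j\<close>-th difference at \<open>k\<close> is the odd contribution of the
  alternating word plus the wanted digit. Computed from the digits of \<open>n\<close> above
  position \<open>j\<close>, it is a diagonal sum of binomial coefficients without its term
  \<open>r = 0\<close>. That missing 1 cancels the odd contribution, so the digit has the parity of
  the full diagonal sum.\<close>

lemma next_levin_digit:
  assumes J: "j = 2 * J" "J > 0" and K: "2 * K + j < 2 ^ m"
    and n: "n div 2 ^ j = power4_sum K"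
    and alt: "\<And>i. i < j \<Longrightarrow> levin_d m n (k + i) = of_bool (even i)"
    and ev: "even ((Suc (k div 2 + J + K)) choose K)"
  shows "levin_d m n (k + j) = 0"
proof -
  let ?q = "2 ^ m :: nat"
  have "[(\<Sum>i\<le>j. (j choose i) * levin_d m n (k + i))
    = (\<Sum>i\<le>j. (j choose i) * (\<Sum>l<?q. binary_digit l n * ((k + i + l) choose l)))] (mod 2)"
    by (intro cong_sum cong_mult cong_refl levin_d_cong)
  from cong_trans[OF this binomial_transform_newton_cong]
  have "[(\<Sum>i\<le>j. (j choose i) * levin_d m n (k + i))
    = (\<Sum>l\<in>{j..<?q}. binary_digit l n * ((k + l) choose (l - j)))] (mod 2)" .
  moreover have "(\<Sum>l\<in>{j..<?q}. binary_digit l n * ((k + l) choose (l - j)))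
    = (\<Sum>l<?q - j. binary_digit l (power4_sum K) * ((k + j + l) choose l))"
  proof (rule sum.reindex_bij_witness[of _ "\<lambda>l. j + l" "\<lambda>l. l - j"])
    fix l assume "l \<in> {j..<?q}"
    then show "binary_digit (l - j) (power4_sum K) * ((k + j + (l - j)) choose (l - j))
      = binary_digit l n * ((k + l) choose (l - j))"
      using binary_digit_add[of j "l - j" n] n by simp
  qed auto
  moreover have "\<dots> = (\<Sum>r=1..K. (k + j + 2 * r) choose (2 * r))"
    by (rule sum_power4_sum_digits) (use K in linarith)
  \<comment> \<open>All set digits of \<open>power4_sum K\<close> are in even positions, so Lucas
    halves both entries of every coefficient.\<close>
  moreover have "[(\<Sum>r=1..K. (k + j + 2 * r) choose (2 * r))
      = (\<Sum>r=1..K. (k div 2 + J + r) choose r)] (mod 2)"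
  proof (rule cong_sum)
    fix r
    have half: "k div 2 + J + r = (k + j + 2 * r) div 2" using J by simp
    show "[(k + j + 2 * r) choose (2 * r) = (k div 2 + J + r) choose r] (mod 2)"
      unfolding half by (rule choose_halves_cong)
  qed
  ultimately have "even (\<Sum>i\<le>j. (j choose i) * levin_d m n (k + i))
      \<longleftrightarrow> even (\<Sum>r=1..K. (k div 2 + J + r) choose r)"
    by (simp only: cong_2_nat_iff)
  moreover have "Suc (\<Sum>r=1..K. (k div 2 + J + r) choose r) = Suc (k div 2 + J + K) choose K"
  proof -
    have "{..K} = insert 0 {1..K}" by auto
    then have "(\<Sum>r\<le>K. (k div 2 + J + r) choose r) = Suc (\<Sum>r=1..K. (k div 2 + J + r) choose r)"
      by simp
    then show ?thesis using sum_choose_lower[of "k div 2 + J" K] by simp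
  qed
  ultimately have "odd (\<Sum>i\<le>j. (j choose i) * levin_d m n (k + i))"
    using ev by (metis even_Suc)
  moreover have "(\<Sum>i\<le>j. (j choose i) * levin_d m n (k + i))
      = (\<Sum>i<j. (j choose i) * of_bool (even i)) + levin_d m n (k + j)"
    using alt by (simp add: lessThan_Suc_atMost[symmetric])
  moreover have "odd (\<Sum>i<j. (j choose i) * of_bool (even i) :: nat)"
    by (rule odd_choose_even_indices) (use J in auto)
  ultimately have "even (levin_d m n (k + j))" by simp
  then show ?thesis using levin_d_less_2[of m n "k + j"] by (auto simp: less_2_cases_iff)
qed

subsection \<open>Binary expansions and visits to the interval\<close>

definition block_start :: "nat \<Rightarrow> nat" where
  "block_start m = (\<Sum>i\<in>{1..<m}. 2 ^ i * 2 ^ 2 ^ i)"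

lemma nth_concat_map_upt:
  assumes "n < M" "k < q"
  shows "concat (map (\<lambda>n. map (f n) [0..<q]) [0..<M]) ! (n * q + k) = f n k"
  using assms
proof (induction M)
  case (Suc M)
  let ?c = "concat (map (\<lambda>n. map (f n) [0..<q]) [0..<M])"
  have len: "length ?c = M * q" by (simp add: length_concat comp_def sum_list_triv)
  show ?case
  proof (cases "n < M")
    case True
    then have "Suc n * q \<le> M * q" by (intro mult_le_mono1) simp
    then have "n * q + k < length ?c" unfolding len using Suc.prems by simp
    then show ?thesis using Suc True by (simp add: nth_append)
  next
    case False
    then have "n = M" using Suc.prems by simp
    then show ?thesis using Suc.prems len by (simp add: nth_append)
  qed
qed simp

lemma snth_flat_levin_blocks:
  assumes "a \<le> m"
  shows "flat (smap levin_block (fromN a)) !! ((\<Sum>i\<in>{a..<m}. 2 ^ i * 2 ^ 2 ^ i) + p)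
    = flat (smap levin_block (fromN m)) !! p"
  using assms
proof (induction rule: inc_induct)
  case (step a)
  have "(\<Sum>i\<in>{a..<m}. 2 ^ i * 2 ^ 2 ^ i) = length (levin_block a) + (\<Sum>i\<in>{Suc a..<m}. 2 ^ i * 2 ^ 2 ^ i)"
    using step.hyps by (simp add: length_levin_block sum.atLeast_Suc_lessThan)
  then show ?case
    using step.IH by (subst flat_levin_blocks) (simp add: shift_snth)
qed simp

lemma snth_levin_digits:
  assumes "1 \<le> m" "n < 2 ^ 2 ^ m" "k < 2 ^ m"
  shows "levin_digits !! (block_start m + (n * 2 ^ m + k)) = levin_d m n k"
proof -
  have "Suc n * 2 ^ m \<le> 2 ^ 2 ^ m * 2 ^ m" using assms by (intro mult_le_mono1) simp
  then have less: "n * 2 ^ m + k < length (levin_block m)"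
    unfolding length_levin_block using assms by (simp add: mult.commute)
  have "levin_digits !! (block_start m + (n * 2 ^ m + k))
    = flat (smap levin_block (fromN m)) !! (n * 2 ^ m + k)"
    unfolding levin_digits_def block_start_def by (rule snth_flat_levin_blocks[OF assms(1)])
  also have "\<dots> = levin_block m ! (n * 2 ^ m + k)"
    using less by (subst flat_levin_blocks) (simp add: shift_snth)
  also have "\<dots> = levin_d m n k"
    unfolding levin_block_def by (rule nth_concat_map_upt) (use assms in auto)
  finally show ?thesis .
qed

lemma snth_levin_digits_wrap:
  assumes "1 \<le> m" "Suc n < 2 ^ 2 ^ m" "k < 2 ^ m" "i \<le> 2 ^ m"
  shows "levin_digits !! (block_start m + (n * 2 ^ m + k) + i) =
    (if k + i < 2 ^ m then levin_d m n (k + i) else levin_d m (Suc n) (k + i))"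
proof (cases "k + i < 2 ^ m")
  case True
  then show ?thesis using snth_levin_digits[of m n "k + i"] assms by (simp add: add.assoc)
next
  case False
  then obtain r where r: "k + i = 2 ^ m + r" by (metis le_add_diff_inverse linorder_not_less)
  then have "r < 2 ^ m" using assms by linarith
  then have "levin_digits !! (block_start m + (Suc n * 2 ^ m + r)) = levin_d m (Suc n) r"
    by (intro snth_levin_digits) (use assms in auto)
  moreover have "block_start m + (n * 2 ^ m + k) + i = block_start m + (Suc n * 2 ^ m + r)"
    using r by simp
  ultimately show ?thesis using False r by (simp only: levin_d_periodic) simp
qed

section \<open>Prefixes of binary expansions and the endpoint 2/3\<close>

primrec prefix_value :: "(nat \<Rightarrow> nat) \<Rightarrow> nat \<Rightarrow> nat" where
  "prefix_value d 0 = 0"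
| "prefix_value d (Suc j) = 2 * prefix_value d j + d j"

lemma prefix_value_less: "(\<And>i. d i < 2) \<Longrightarrow> prefix_value d j < 2 ^ j"
proof (induction j)
  case (Suc j)
  then have "prefix_value d j < 2 ^ j" "d j < 2" by auto
  then show ?case by simp
qed simp

lemma prefix_value_inj:
  assumes "\<And>i. d i < 2" "\<And>i. d' i < 2" "prefix_value d j = prefix_value d' j" "i < j"
  shows "d i = d' i"
  using assms(3,4)
proof (induction j)
  case (Suc j)
  have "2 * prefix_value d j + d j = 2 * prefix_value d' j + d' j" "d j < 2" "d' j < 2"
    using Suc.prems assms by auto
  then have "prefix_value d j = prefix_value d' j" "d j = d' j" by presburger+
  then show ?case using Suc by (auto simp: less_Suc_eq)
qed simp

lemma prefix_value_cong:
  "(\<And>i. i < j \<Longrightarrow> d i = d' i) \<Longrightarrow> prefix_value d j = prefix_value d' j"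
  by (induction j) auto

definition binary_series :: "(nat \<Rightarrow> nat) \<Rightarrow> real" where
  "binary_series d = (\<Sum>i. real (d i) / 2 ^ Suc i)"

lemma sums_half_powers: "(\<lambda>i. 1 / 2 ^ Suc i :: real) sums 1"
  using power_half_series by (simp add: power_one_over)

lemma summable_binary_series:
  assumes "\<And>i. d i < (2::nat)"
  shows "summable (\<lambda>i. real (d i) / 2 ^ Suc i)"
proof (rule summable_comparison_test)
  have "d i \<le> 1" for i using assms[of i] by simp
  then show "\<exists>N. \<forall>i\<ge>N. norm (real (d i) / 2 ^ Suc i) \<le> 1 / 2 ^ Suc i"
    by (auto intro!: divide_right_mono)
qed (use sums_half_powers in \<open>rule sums_summable\<close>)

lemma binary_series_bounds:
  assumes "\<And>i. d i < (2::nat)"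
  shows "0 \<le> binary_series d" "binary_series d \<le> 1"
proof -
  show "0 \<le> binary_series d"
    unfolding binary_series_def by (intro suminf_nonneg summable_binary_series assms) auto
  have "d i \<le> 1" for i using assms[of i] by simp
  then have "binary_series d \<le> (\<Sum>i. 1 / 2 ^ Suc i)"
    unfolding binary_series_def using sums_half_powers
    by (intro suminf_le summable_binary_series assms divide_right_mono) (auto simp: sums_iff)
  also have "\<dots> = 1" using sums_half_powers by (simp add: sums_iff)
  finally show "binary_series d \<le> 1" .
qed

lemma binary_series_shift:
  assumes "\<And>i. d i < (2::nat)"
  shows "2 ^ j * binary_series d = real (prefix_value d j) + binary_series (\<lambda>i. d (j + i))"
proof (induction j)
  case (Suc j)
  let ?d = "\<lambda>i. d (j + i)"
  have "binary_series ?d = real (d j) / 2 + (\<Sum>i. real (?d (Suc i)) / 2 ^ Suc (Suc i))"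
    unfolding binary_series_def
    using suminf_split_head[OF summable_binary_series[of ?d]] assms by simp
  also have "(\<Sum>i. real (?d (Suc i)) / 2 ^ Suc (Suc i)) = (\<Sum>i. (real (?d (Suc i)) / 2 ^ Suc i) / 2)"
    by (simp add: field_simps)
  also have "\<dots> = binary_series (\<lambda>i. ?d (Suc i)) / 2"
    unfolding binary_series_def by (rule suminf_divide) (use assms in \<open>rule summable_binary_series\<close>)
  finally have "2 * binary_series ?d = real (d j) + binary_series (\<lambda>i. d (Suc j + i))" by simp
  then show ?case using Suc.IH by simp
qed simp

definition hit :: "nat \<Rightarrow> bool" where
  "hit N \<longleftrightarrow> frac (2 ^ N * levin_number) < 2 / 3"

text \<open>For even \<open>j\<close> this is the integer part of \<open>2 / 3 * 2 ^ j\<close>,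
  given by the first \<open>j\<close> digits of 2/3.\<close>

definition alternating_value :: "nat \<Rightarrow> nat" where
  "alternating_value = prefix_value (\<lambda>i. of_bool (even i))"

lemma alternating_value_even:
  assumes "even j"
  shows "3 * alternating_value j + 2 = 2 * 2 ^ j"
proof -
  have "3 * alternating_value (2 * J) + 2 = 2 * 2 ^ (2 * J)" for J
    by (induction J) (auto simp: alternating_value_def)
  then show ?thesis using assms by (auto elim: evenE)
qed

text \<open>The tail of the expansion from \<open>N\<close> lies in the closed interval from
  \<open>v / 2 ^ j\<close> to \<open>(v + 1) / 2 ^ j\<close>, and the second hypothesis keeps even
  its right end below 2/3. Being less than 1, the tail is then the fractional part.\<close>

lemma hit_if_less:
  assumes "prefix_value (\<lambda>i. levin_digits !! (N + i)) j = v" "3 * (v + 1) < 2 * 2 ^ j"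
  shows "hit N"
proof -
  let ?d = "\<lambda>i. levin_digits !! (N + i)"
  have "2 ^ j * binary_series ?d = real v + binary_series (\<lambda>i. ?d (j + i))"
    using assms(1) levin_digit_less_2 by (subst binary_series_shift) auto
  also have "\<dots> \<le> real v + 1" using binary_series_bounds levin_digit_less_2 by simp
  finally have "3 * (2 ^ j * binary_series ?d) \<le> 3 * (real v + 1)" by simp
  also have "\<dots> = real (3 * (v + 1))" by simp
  also have "\<dots> < real (2 * 2 ^ j)" using assms(2) by (simp only: of_nat_less_iff)
  also have "\<dots> = 2 ^ j * 2" by simp
  finally have "2 ^ j * (3 * binary_series ?d) < 2 ^ j * 2" by simp
  then have less: "binary_series ?d < 2 / 3" by simp
  have nonneg: "0 \<le> binary_series ?d" using binary_series_bounds levin_digit_less_2 by simp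
  have "2 ^ N * levin_number = real (prefix_value (\<lambda>i. levin_digits !! i) N) + binary_series ?d"
    using binary_series_shift[of "\<lambda>i. levin_digits !! i" N] levin_digit_less_2
    by (simp add: levin_number_def binary_series_def)
  then have "frac (2 ^ N * levin_number) = binary_series ?d"
    using less nonneg by (simp add: frac_unique_iff)
  with less show ?thesis by (simp add: hit_def)
qed

section \<open>Counting visits in an aligned block\<close>

lemma block_eq_interval: "{n :: nat. n div 2 ^ j = h} = {h * 2 ^ j..<h * 2 ^ j + 2 ^ j}"
proof (intro set_eqI iffI)
  fix n :: nat
  assume "n \<in> {n. n div 2 ^ j = h}"
  then have "n = h * 2 ^ j + n mod 2 ^ j" using div_mult_mod_eq[of n "2 ^ j"] by simp
  moreover have "n mod 2 ^ j < 2 ^ j" by simp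
  ultimately show "n \<in> {h * 2 ^ j..<h * 2 ^ j + 2 ^ j}" unfolding atLeastLessThan_iff by linarith
next
  fix n :: nat
  assume "n \<in> {h * 2 ^ j..<h * 2 ^ j + 2 ^ j}"
  then show "n \<in> {n. n div 2 ^ j = h}"
    by (auto intro!: div_nat_eqI simp: mult.commute)
qed

lemma card_block: "card {n :: nat. n div 2 ^ j = h} = 2 ^ j" "finite {n :: nat. n div 2 ^ j = h}"
  by (simp_all add: block_eq_interval)

lemma card_less_if_inj:
  fixes f :: "'a \<Rightarrow> nat"
  assumes "finite B" "inj_on f B" "f ` B \<subseteq> {..<card B}" "F \<le> card B"
  shows "card {n \<in> B. f n < F} = F"
proof -
  have "f ` B = {..<card B}"
    using assms by (intro card_subset_eq) (auto simp: card_image)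
  then have "f ` {n \<in> B. f n < F} = {..<F}"
    using assms(4) by (auto simp: image_iff set_eq_iff) (metis order_less_le_trans)+
  moreover have "inj_on f {n \<in> B. f n < F}" using assms(2) by (rule inj_on_subset) auto
  ultimately show ?thesis by (metis card_image card_lessThan)
qed

lemma block_word_less_2: "block_word m j k n i < 2"
  by (simp add: block_word_def)

lemma card_block_word_less:
  assumes "j \<le> 2 ^ m" "k < 2 ^ m" "F \<le> 2 ^ j"
  shows "card {n \<in> {n. n div 2 ^ j = h}. prefix_value (block_word m j k n) j < F} = F"
proof (rule card_less_if_inj)
  show "inj_on (\<lambda>n. prefix_value (block_word m j k n) j) {n. n div 2 ^ j = h}"
  proof (rule inj_onI)
    fix n n' assume n: "n \<in> {n. n div 2 ^ j = h}" "n' \<in> {n. n div 2 ^ j = h}"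
      and eq: "prefix_value (block_word m j k n) j = prefix_value (block_word m j k n') j"
    from n have "n div 2 ^ j = n' div 2 ^ j" by simp
    then show "n = n'"
      using prefix_value_inj[OF block_word_less_2 block_word_less_2 eq]
      by (rule block_word_inj[OF assms(1,2)])
  qed
  show "(\<lambda>n. prefix_value (block_word m j k n) j) ` {n. n div 2 ^ j = h} \<subseteq> {..<card {n :: nat. n div 2 ^ j = h}}"
    using prefix_value_less[OF block_word_less_2] by (auto simp: card_block)
qed (use assms card_block in auto)

definition block_hits :: "nat \<Rightarrow> nat \<Rightarrow> nat \<Rightarrow> nat \<Rightarrow> nat set" where
  "block_hits m j h k = {n. n div 2 ^ j = h \<and> hit (block_start m + (n * 2 ^ m + k))}"

lemma finite_block_hits [simp]: "finite (block_hits m j h k)"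
  by (rule finite_subset[OF _ card_block(2)[of j h]]) (auto simp: block_hits_def)

lemma Suc_less_if_div:
  assumes "Suc h * 2 ^ j < 2 ^ 2 ^ m" "n div 2 ^ j = h"
  shows "Suc n < 2 ^ 2 ^ m"
proof -
  have "n < Suc h * 2 ^ j" using assms(2) div_less_iff_less_mult[of "2 ^ j" n "Suc h"] by simp
  with assms(1) show ?thesis by linarith
qed

text \<open>Every prefix below the alternating one forces a visit. \<open>block_word\<close> can
  differ from the true digits only at the last index of the block, which costs the 1.\<close>

lemma card_block_hits_ge:
  assumes m: "1 \<le> m" and j: "even j" "j \<le> 2 ^ m" and k: "k < 2 ^ m"
    and h: "Suc h * 2 ^ j < 2 ^ 2 ^ m"
  shows "alternating_value j \<le> card (block_hits m j h k) + 1"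
proof -
  let ?F = "alternating_value j"
  have F: "3 * ?F + 2 = 2 * 2 ^ j" using j(1) by (rule alternating_value_even)
  let ?S = "{n \<in> {n. n div 2 ^ j = h}. prefix_value (block_word m j k n) j < ?F}"
  have "?S \<subseteq> insert (Suc h * 2 ^ j - 1) (block_hits m j h k)"
  proof
    fix n assume n: "n \<in> ?S"
    show "n \<in> insert (Suc h * 2 ^ j - 1) (block_hits m j h k)"
    proof (cases "block_succ j n = Suc n")
      case True
      have "prefix_value (\<lambda>i. levin_digits !! (block_start m + (n * 2 ^ m + k) + i)) j
        = prefix_value (block_word m j k n) j"
        using True m j k n Suc_less_if_div[OF h]
        by (intro prefix_value_cong) (simp add: snth_levin_digits_wrap block_word_def)
      then have "hit (block_start m + (n * 2 ^ m + k))"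
        by (rule hit_if_less) (use n F in simp)
      with n show ?thesis by (simp add: block_hits_def)
    next
      case False
      then have "Suc n = Suc h * 2 ^ j" using block_succ_cases n by blast
      then have "n = Suc h * 2 ^ j - 1" by linarith
      then show ?thesis by blast
    qed
  qed
  then have "card ?S \<le> card (insert (Suc h * 2 ^ j - 1) (block_hits m j h k))"
    by (intro card_mono) auto
  also have "\<dots> \<le> card (block_hits m j h k) + 1" by (simp add: card_insert_if)
  finally show ?thesis using F j k by (subst (asm) card_block_word_less) auto
qed

text \<open>The parameter \<open>F\<close> treats two cases at once: prefixes strictly below
  1010...10, and, for \<open>F = Suc (alternating_value j)\<close>, also that word itself. Only the
  latter needs the digit after the window, which the strict bound on \<open>k + j\<close> keeps in
  the same word.\<close>

lemma card_block_hits_unwrapped_ge: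
  assumes m: "1 \<le> m" and j: "even j" and k: "k + j < 2 ^ m"
    and h: "Suc h * 2 ^ j < 2 ^ 2 ^ m"
    and F: "F \<le> Suc (alternating_value j)"
    and next_digit: "\<And>n. F = Suc (alternating_value j) \<Longrightarrow> n div 2 ^ j = h \<Longrightarrow>
      (\<And>i. i < j \<Longrightarrow> levin_d m n (k + i) = of_bool (even i)) \<Longrightarrow> levin_d m n (k + j) = 0"
  shows "F \<le> card (block_hits m j h k)"
proof -
  let ?V = "alternating_value j"
  have V: "3 * ?V + 2 = 2 * 2 ^ j" using j by (rule alternating_value_even)
  let ?S = "{n \<in> {n. n div 2 ^ j = h}. prefix_value (block_word m j k n) j < F}"
  have "?S \<subseteq> block_hits m j h k"
  proof
    fix n assume n: "n \<in> ?S"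
    let ?N = "block_start m + (n * 2 ^ m + k)"
    have digit: "levin_digits !! (?N + i) = levin_d m n (k + i)" if "i \<le> j" for i
      using that m k n Suc_less_if_div[OF h] by (simp add: snth_levin_digits_wrap)
    have word: "block_word m j k n i = levin_d m n (k + i)" if "i < j" for i
      using that k by (simp add: block_word_def)
    have pv: "prefix_value (\<lambda>i. levin_digits !! (?N + i)) j = prefix_value (block_word m j k n) j"
      by (rule prefix_value_cong) (simp add: digit word)
    have "hit ?N"
    proof (cases "prefix_value (block_word m j k n) j < ?V")
      case True
      show ?thesis by (rule hit_if_less[OF pv]) (use True V in simp)
    next
      case False
      with n F have eq: "prefix_value (block_word m j k n) j = ?V" "F = Suc ?V" by auto
      have "levin_d m n (k + i) = of_bool (even i)" if "i < j" for i
      proof -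
        have "block_word m j k n i = of_bool (even i)"
          by (rule prefix_value_inj[OF block_word_less_2 _ eq(1)[unfolded alternating_value_def] that])
            simp
        then show ?thesis using word[OF that] by simp
      qed
      then have "levin_d m n (k + j) = 0" using next_digit eq n by blast
      \<comment> \<open>With the digit 0 appended,
        \<open>3 * (2 * ?V + 1) = 2 * 2 ^ Suc j - 1\<close>, just below the threshold.\<close>
      then have "prefix_value (\<lambda>i. levin_digits !! (?N + i)) (Suc j) = 2 * ?V"
        using pv eq digit[of j] by simp
      then show ?thesis by (rule hit_if_less) (use V in simp)
    qed
    with n show "n \<in> block_hits m j h k" by (simp add: block_hits_def)
  qed
  then have "card ?S \<le> card (block_hits m j h k)" by (intro card_mono) auto
  then show ?thesis using V F k by (subst (asm) card_block_word_less) auto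
qed

subsection \<open>Summation over offsets and blocks\<close>

definition hit_error :: "nat \<Rightarrow> real" where
  "hit_error n = of_bool (hit n) - 2 / 3"

lemma sum_lessThan_add:
  fixes f :: "nat \<Rightarrow> 'a :: comm_monoid_add"
  shows "(\<Sum>i<a + b. f i) = (\<Sum>i<a. f i) + (\<Sum>i<b. f (a + i))"
  by (induction b) (simp_all add: add.assoc)

lemma sum_lessThan_mult:
  fixes f :: "nat \<Rightarrow> 'a :: comm_monoid_add"
  shows "(\<Sum>i<T * q. f i) = (\<Sum>n<T. \<Sum>k<q. f (n * q + k))"
proof (induction T)
  case (Suc T)
  have "(\<Sum>i<Suc T * q. f i) = (\<Sum>i<T * q + q. f i)" by (simp add: add.commute)
  with Suc show ?case by (simp add: sum_lessThan_add)
qed simp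

lemma sum_hit_error_le_discrepancy:
  assumes "N \<ge> 1"
  shows "\<bar>\<Sum>n<N. hit_error n\<bar> \<le> real N * discrepancy (\<lambda>n. frac (2 ^ n * levin_number)) N"
proof -
  let ?x = "\<lambda>n. frac (2 ^ n * levin_number)"
  have set: "{n. n < N \<and> 0 \<le> ?x n \<and> ?x n < 2 / 3} = {..<N} \<inter> {n. hit n}"
    by (auto simp: hit_def)
  have "(\<Sum>n<N. hit_error n) = real (card ({..<N} \<inter> {n. hit n})) - 2 / 3 * real N"
    unfolding hit_error_def sum_subtractf by simp
  also have "\<dots> = real N * (1 / real N * real (card {n. n < N \<and> 0 \<le> ?x n \<and> ?x n < 2 / 3}) - (2 / 3 - 0))"
    using assms unfolding set by (simp add: field_simps)
  finally have "\<bar>\<Sum>n<N. hit_error n\<bar>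
      = real N * \<bar>1 / real N * real (card {n. n < N \<and> 0 \<le> ?x n \<and> ?x n < 2 / 3}) - (2 / 3 - 0)\<bar>"
    by (simp only: abs_mult)
  also have "\<dots> \<le> real N * discrepancy ?x N"
    unfolding discrepancy_def
    by (intro mult_left_mono cSUP_upper2[OF bdd_above_discrepancy, of "(0, 2 / 3)"]) auto
  finally show ?thesis .
qed

lemma three_times_power4_sum: "3 * power4_sum K + 4 = 4 * 4 ^ K"
  by (induction K) auto

text \<open>\<open>power4_sum L\<close> is \<open>4 + 4 ^ 2 + \<dots> + 4 ^ L\<close>, and removing its first \<open>i\<close> summands and dividing
  by \<open>4 ^ i\<close> gives \<open>power4_sum (L - i)\<close> again.\<close>

lemma sum_power4_sum_blocks:
  fixes g :: "nat \<Rightarrow> 'a :: comm_monoid_add"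
  assumes "J \<le> L"
  shows "(\<Sum>n<power4_sum L. g n) = (\<Sum>n<power4_sum (L - J) * 4 ^ J. g n)
    + (\<Sum>i=1..J. \<Sum>n | n div 2 ^ (2 * i) = power4_sum (L - i). g n)"
  using assms
proof (induction J)
  case (Suc J)
  let ?P = "power4_sum (L - Suc J)" and ?j = "2 * Suc J"
  have pow: "(2::nat) ^ ?j = 4 ^ Suc J" by (simp only: power_mult) simp
  have "L - J = Suc (L - Suc J)" using Suc.prems by simp
  \<comment> \<open>The recursion of \<open>power4_sum\<close> splits off one aligned block of
    length \<open>2 ^ ?j\<close> at the right end.\<close>
  then have "power4_sum (L - J) * 4 ^ J = ?P * 2 ^ ?j + 2 ^ ?j" unfolding pow by (simp add: algebra_simps)
  then have "(\<Sum>n<power4_sum (L - J) * 4 ^ J. g n)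
      = (\<Sum>n<?P * 2 ^ ?j. g n) + (\<Sum>n | n div 2 ^ ?j = ?P. g n)"
    unfolding block_eq_interval
    using sum.atLeastLessThan_concat[of 0 "?P * 2 ^ ?j" "?P * 2 ^ ?j + 2 ^ ?j" g]
    by (simp only: atLeast0LessThan le0 le_add1)
  with Suc show ?case unfolding pow[symmetric] by (simp add: ac_simps)
qed simp

lemma sum_block_hit_error:
  "(\<Sum>n | n div 2 ^ j = h. hit_error (block_start m + (n * 2 ^ m + k)))
    = real (card (block_hits m j h k)) - 2 / 3 * 2 ^ j"
proof -
  have "{n. n div 2 ^ j = h} \<inter> {n. hit (block_start m + (n * 2 ^ m + k))} = block_hits m j h k"
    by (auto simp: block_hits_def)
  then show ?thesis
    unfolding hit_error_def sum_subtractf using card_block[of j h] by simp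
qed

text \<open>As \<open>alternating_value j\<close> is 2/3 below the exact
  \<open>2 / 3 * 2 ^ j\<close>, the three counts give errors at least 1/3 (even coefficient), -2/3
  (odd coefficient) and -5/3 (wrapped window). The weight 7/3 makes the claim at most -2 in the last
  case.\<close>

lemma block_hit_error_ge:
  fixes a i k :: nat
  defines "m \<equiv> a + 4" and "H \<equiv> 2 ^ a"
  assumes i: "1 \<le> i" "i < H" and k: "k < 2 ^ m"
  shows "real (card (block_hits m (2 * i) (power4_sum (H - 1 - i)) k)) - 2 / 3 * 2 ^ (2 * i)
    \<ge> 1 / 3 - of_bool (odd ((k div 2 + H) choose (H - 1 - i))) - 7 / 3 * of_bool (2 ^ m \<le> k + 2 * i)"
proof -
  let ?K = "H - 1 - i" and ?j = "2 * i" and ?V = "alternating_value (2 * i)"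
  let ?C = "card (block_hits m ?j (power4_sum ?K) k)"
  have q: "2 ^ m = 16 * H" by (simp add: m_def H_def power_add)
  have "3 * ?V + 2 = 2 * 2 ^ ?j" by (rule alternating_value_even) simp
  then have "real (3 * ?V + 2) = real (2 * 2 ^ ?j)" by (rule arg_cong)
  then have V: "real ?V = 2 / 3 * 2 ^ ?j - 2 / 3" by simp
  have h: "Suc (power4_sum ?K) * 2 ^ ?j < 2 ^ 2 ^ m"
  proof -
    have "Suc (power4_sum ?K) * 2 ^ ?j \<le> 4 ^ Suc ?K * 2 ^ ?j"
      using three_times_power4_sum[of ?K] by (intro mult_le_mono1) simp
    also have "\<dots> = (4::nat) ^ (Suc ?K + i)" by (simp only: power_add power_mult) simp
    also have "\<dots> = 2 ^ (2 * H)" using i by (simp add: power_mult)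
    also have "\<dots> < 2 ^ 2 ^ m" using i by (simp add: q)
    finally show ?thesis .
  qed
  have m1: "1 \<le> m" by (simp add: m_def)
  show ?thesis
  proof (cases "2 ^ m \<le> k + ?j")
    case True
    have "?V \<le> ?C + 1"
      by (rule card_block_hits_ge[OF m1 _ _ k h]) (use i q in auto)
    then have "real ?V \<le> real ?C + 1" by linarith
    with V True show ?thesis by simp
  next
    case False
    then have kj: "k + ?j < 2 ^ m" by simp
    show ?thesis
    proof (cases "odd ((k div 2 + H) choose ?K)")
      case True
      have "?V \<le> ?C" by (rule card_block_hits_unwrapped_ge[OF m1 _ kj h]) auto
      with V True show ?thesis by simp
    next
      case even: False
      have "Suc ?V \<le> ?C"
      proof (rule card_block_hits_unwrapped_ge[OF m1 _ kj h])
        fix n assume n: "n div 2 ^ ?j = power4_sum ?K"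
          and alt: "\<And>l. l < ?j \<Longrightarrow> levin_d m n (k + l) = of_bool (even l)"
        \<comment> \<open>The top index does not depend on \<open>i\<close>; this is what makes the
          exceptional pairs countable by \<open>card_odd_choose\<close>.\<close>
        have "Suc (k div 2 + i + ?K) = k div 2 + H" using i by simp
        with even have ev: "even (Suc (k div 2 + i + ?K) choose ?K)" by simp
        show "levin_d m n (k + ?j) = 0"
          by (rule next_levin_digit[OF refl _ _ n alt ev]) (use i q in auto)
      qed auto
      then have "real (Suc ?V) \<le> real ?C" by (simp only: of_nat_le_iff)
      with V even False show ?thesis by simp
    qed
  qed
qed

text \<open>Each \<open>x = k div 2\<close> comes from two offsets, and
  \<open>x + H < 9 * H \<le> 2 ^ (4 + a)\<close>, so the count with \<open>b = 4\<close> gives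
  \<open>2 * 2 ^ 4 * 3 ^ a\<close>.\<close>

lemma sum_odd_choose_le:
  fixes a :: nat
  defines "H \<equiv> 2 ^ a"
  shows "(\<Sum>k<16 * H. \<Sum>i=1..H - 1. of_bool (odd ((k div 2 + H) choose (H - 1 - i)))) \<le> (32 * 3 ^ a :: nat)"
proof -
  let ?f = "\<lambda>x. \<Sum>i=1..H - 1. of_bool (odd ((x + H) choose (H - 1 - i))) :: nat"
  let ?P = "{(x, i). x < 8 * H \<and> i \<in> {1..H - 1} \<and> odd ((x + H) choose (H - 1 - i))}"
  have "(\<Sum>k<16 * H. ?f (k div 2)) = (\<Sum>k<(8 * H) * 2. ?f (k div 2))" by (simp add: mult.commute)
  also have "\<dots> = (\<Sum>x<8 * H. \<Sum>k<2. ?f ((x * 2 + k) div 2))" by (rule sum_lessThan_mult)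
  also have "\<dots> = (\<Sum>x<8 * H. 2 * ?f x)"
  proof -
    have "(\<Sum>k<2. F ((x * 2 + k) div 2)) = 2 * F x" for F :: "nat \<Rightarrow> nat" and x
    proof -
      have "{..<2} = {0, 1 :: nat}" by auto
      then show ?thesis by simp
    qed
    from this[of ?f] show ?thesis by (intro sum.cong refl)
  qed
  also have "\<dots> = 2 * (\<Sum>x<8 * H. ?f x)" by (rule sum_distrib_left[symmetric])
  also have "(\<Sum>x<8 * H. ?f x)
      = (\<Sum>p\<in>{..<8 * H} \<times> {1..H - 1}. of_bool (case p of (x, i) \<Rightarrow> odd ((x + H) choose (H - 1 - i))))"
    unfolding sum.cartesian_product by (rule sum.cong) auto
  also have "\<dots> = card (({..<8 * H} \<times> {1..H - 1}) \<inter> {(x, i). odd ((x + H) choose (H - 1 - i))})"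
    by (subst sum_of_bool_eq) (auto simp: Collect_case_prod_Sigma)
  also have "({..<8 * H} \<times> {1..H - 1}) \<inter> {(x, i). odd ((x + H) choose (H - 1 - i))} = ?P" by auto
  finally have eq: "(\<Sum>k<16 * H. ?f (k div 2)) = 2 * card ?P" .
  have "card ?P \<le> card {(x, r). x < 2 ^ (4 + a) \<and> r < 2 ^ a \<and> odd (x choose r)}"
  proof (rule card_inj_on_le[where f = "\<lambda>(x, i). (x + H, H - 1 - i)"])
    show "inj_on (\<lambda>(x, i). (x + H, H - 1 - i)) ?P" by (auto simp: inj_on_def)
    show "(\<lambda>(x, i). (x + H, H - 1 - i)) ` ?P \<subseteq> {(x, r). x < 2 ^ (4 + a) \<and> r < 2 ^ a \<and> odd (x choose r)}"
      by (auto simp: H_def power_add)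
    show "finite {(x, r). x < 2 ^ (4 + a) \<and> r < 2 ^ a \<and> odd (x choose r)}"
      by (rule finite_subset[of _ "{..<2 ^ (4 + a)} \<times> {..<2 ^ a}"]) auto
  qed
  then have "card ?P \<le> 2 ^ 4 * 3 ^ a" unfolding card_odd_choose .
  then show ?thesis unfolding eq by simp
qed

text \<open>13 is the least exponent for which this holds; it bounds the number of odd coefficients
  by \<open>H ^ 2\<close>.\<close>

lemma power_three_le: "a \<ge> 13 \<Longrightarrow> 32 * 3 ^ a \<le> (4 :: nat) ^ a"
proof (induction rule: dec_induct)
  case base
  show ?case by (simp add: power_numeral_reduce)
qed simp

text \<open>Over all pairs the gain is \<open>16 / 3 * H * (H - 1)\<close>, the wrapped pairs cost
  \<open>7 / 3 * H * (H - 1)\<close> and the odd coefficients at most \<open>H ^ 2\<close>. What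
  remains is \<open>2 * H ^ 2 - 3 * H\<close>, which is enough once
  \<open>H \<ge> 3\<close>.\<close>

lemma hit_error_segment_ge:
  fixes a :: nat
  defines "m \<equiv> a + 4" and "H \<equiv> 2 ^ a"
  assumes "a \<ge> 13"
  shows "(\<Sum>n<power4_sum (H - 1) * 2 ^ m. hit_error (block_start m + n)) \<ge> (real H)\<^sup>2"
proof -
  let ?o = "\<lambda>k i. odd ((k div 2 + H) choose (H - 1 - i))"
  have q: "2 ^ m = 16 * H" by (simp add: m_def H_def power_add)
  have H: "H \<ge> 1" by (simp add: H_def)
  have "(\<Sum>n<power4_sum (H - 1) * 2 ^ m. hit_error (block_start m + n))
      = (\<Sum>n<power4_sum (H - 1). \<Sum>k<2 ^ m. hit_error (block_start m + (n * 2 ^ m + k)))"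
    by (rule sum_lessThan_mult)
  also have "\<dots> = (\<Sum>k<2 ^ m. \<Sum>n<power4_sum (H - 1). hit_error (block_start m + (n * 2 ^ m + k)))"
    by (rule sum.swap)
  also have "\<dots> = (\<Sum>k<2 ^ m. \<Sum>i=1..H - 1.
      real (card (block_hits m (2 * i) (power4_sum (H - 1 - i)) k)) - 2 / 3 * 2 ^ (2 * i))"
  proof -
    \<comment> \<open>With all summands split off, the leftover initial interval is empty because
      \<open>power4_sum 0 = 0\<close>.\<close>
    have "(\<Sum>n<power4_sum (H - 1). g n)
        = (\<Sum>i=1..H - 1. \<Sum>n | n div 2 ^ (2 * i) = power4_sum (H - 1 - i). g n)" for g :: "nat \<Rightarrow> real"
      using sum_power4_sum_blocks[OF order_refl, of g "H - 1"] by simp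
    then show ?thesis by (simp only: sum_block_hit_error)
  qed
  also have "\<dots> \<ge> (\<Sum>k<2 ^ m. \<Sum>i=1..H - 1. 1 / 3 - of_bool (?o k i) - 7 / 3 * of_bool (2 ^ m \<le> k + 2 * i))"
    unfolding m_def H_def by (intro sum_mono block_hit_error_ge) auto
  also have "(\<Sum>k<2 ^ m. \<Sum>i=1..H - 1. 1 / 3 - of_bool (?o k i) - 7 / 3 * of_bool (2 ^ m \<le> k + 2 * i))
      = 1 / 3 * real (16 * H * (H - 1)) - real (\<Sum>k<16 * H. \<Sum>i=1..H - 1. of_bool (?o k i))
        - 7 / 3 * real (\<Sum>k<16 * H. \<Sum>i=1..H - 1. of_bool (16 * H \<le> k + 2 * i))"
  proof -
    have "(\<Sum>k<16 * H. \<Sum>i=1..H - 1. 1 / 3 :: real) = 1 / 3 * real (16 * H * (H - 1))"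
      using H by (simp add: of_nat_diff)
    then show ?thesis by (simp only: q sum_subtractf of_nat_sum of_nat_of_bool sum_distrib_left)
  qed
  also have "(\<Sum>k<16 * H. \<Sum>i=1..H - 1. of_bool (16 * H \<le> k + 2 * i)) = H * (H - 1)"
  proof -
    have "(\<Sum>k<16 * H. of_bool (16 * H \<le> k + 2 * i)) = 2 * i" if "i \<in> {1..H - 1}" for i
    proof -
      have "{..<16 * H} \<inter> {k. 16 * H \<le> k + 2 * i} = {16 * H - 2 * i..<16 * H}" by auto
      moreover have "2 * i \<le> 16 * H" using that by auto
      ultimately show ?thesis by simp
    qed
    then have "(\<Sum>i=1..H - 1. \<Sum>k<16 * H. of_bool (16 * H \<le> k + 2 * i)) = (\<Sum>i=1..H - 1. 2 * i)"
      by (rule sum.cong[OF refl])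
    also have "\<dots> = H * (H - 1)"
    proof -
      have "(\<Sum>i=1..n. 2 * i) = Suc n * n" for n :: nat by (induction n) auto
      from this[of "H - 1"] H show ?thesis by simp
    qed
    finally show ?thesis by (subst sum.swap)
  qed
  finally have ge: "(\<Sum>n<power4_sum (H - 1) * 2 ^ m. hit_error (block_start m + n))
      \<ge> 1 / 3 * real (16 * H * (H - 1)) - real (\<Sum>k<16 * H. \<Sum>i=1..H - 1. of_bool (?o k i))
        - 7 / 3 * real (H * (H - 1))" .
  have "(\<Sum>k<16 * H. \<Sum>i=1..H - 1. of_bool (?o k i)) \<le> (32 * 3 ^ a :: nat)"
    unfolding H_def by (rule sum_odd_choose_le)
  also have "\<dots> \<le> (4 :: nat) ^ a" by (rule power_three_le) fact
  also have "\<dots> = H * H" unfolding H_def by (simp flip: power_mult_distrib)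
  finally have "real (\<Sum>k<16 * H. \<Sum>i=1..H - 1. of_bool (?o k i)) \<le> real (H * H)"
    by (simp only: of_nat_le_iff)
  moreover have "real (H * (H - 1)) = real H * real H - real H" using H by (simp add: of_nat_diff algebra_simps)
  moreover have "real (16 * H * (H - 1)) = 16 * (real H * real H - real H)" using H by (simp add: of_nat_diff algebra_simps)
  moreover have "3 * real H \<le> real H * real H"
  proof -
    have "(2::nat) ^ 13 \<le> H" unfolding H_def using assms(3) by (intro power_increasing) auto
    then have "3 \<le> real H" by simp
    then show ?thesis by (intro mult_right_mono) auto
  qed
  moreover have "real (H * H) = real H * real H" by simp
  ultimately show ?thesis using ge unfolding power2_eq_square by linarith
qed

section \<open>Size of the segment ends and conclusion\<close>

lemma le_block_start: "m \<le> Suc (block_start m)"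
proof (induction m)
  case (Suc m)
  show ?case
  proof (cases "m = 0")
    case False
    then have "block_start (Suc m) = block_start m + 2 ^ m * 2 ^ 2 ^ m"
      by (simp add: block_start_def sum.atLeastLessThan_Suc)
    moreover have "(1::nat) \<le> 2 ^ m * 2 ^ 2 ^ m" by simp
    ultimately show ?thesis using Suc by linarith
  qed simp
qed simp

lemma block_start_le: "block_start m \<le> 2 ^ (2 * 2 ^ m)"
proof (induction m)
  case 0
  then show ?case by (simp add: block_start_def)
next
  case (Suc m)
  let ?q = "2 ^ m :: nat"
  show ?case
  proof (cases "m = 0")
    case True
    then show ?thesis by (simp add: block_start_def)
  next
    case False
    then have "block_start (Suc m) = block_start m + ?q * 2 ^ ?q"
      by (simp add: block_start_def sum.atLeastLessThan_Suc)
    also have "\<dots> \<le> 2 ^ (2 * ?q) + 2 ^ ?q * 2 ^ ?q"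
      using Suc by (intro add_mono mult_le_mono1) (auto intro: less_imp_le less_exp)
    also have "\<dots> = 2 ^ (2 * ?q + 1)" by (simp add: mult_2 power_add)
    also have "\<dots> \<le> 2 ^ (2 * 2 ^ Suc m)"
      by (rule power_increasing) auto
    finally show ?thesis .
  qed
qed

theorem theorem1:
  shows "\<exists>c::real. c > 0 \<and>
    infinite {N::nat. N \<ge> 1 \<and>
      discrepancy (\<lambda>n. frac (2 ^ n * levin_number)) N \<ge> c * ((ln (real N))\<^sup>2 / real N)}"
proof (intro exI conjI)
  let ?D = "discrepancy (\<lambda>n. frac (2 ^ n * levin_number))"
  \<comment> \<open>Chosen so that \<open>ln N \<le> 3 * 2 ^ m = 48 * H\<close> yields
    \<open>?c * (48 * H) ^ 2 = H ^ 2 / 2\<close>.\<close>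
  let ?c = "1 / 4608 :: real"
  show "0 < ?c" by simp
  show "infinite {N. 1 \<le> N \<and> ?c * ((ln (real N))\<^sup>2 / real N) \<le> ?D N}"
    unfolding infinite_nat_iff_unbounded
  proof
    fix M :: nat
    \<comment> \<open>The 13 serves the segment estimate, and adding \<open>M\<close> pushes the
      segment beyond \<open>M\<close>.\<close>
    define a where "a = M + 13"
    define m where "m = a + 4"
    define H where "H = (2::nat) ^ a"
    define N1 where "N1 = block_start m"
    define N2 where "N2 = N1 + power4_sum (H - 1) * 2 ^ m"
    have q: "2 ^ m = 16 * H" by (simp add: m_def H_def power_add)
    have H: "H \<ge> 1" by (simp add: H_def)
    have N1: "M < N1" using le_block_start[of m] by (simp add: N1_def m_def a_def)
    have le: "N1 \<le> N2" by (simp add: N2_def)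
    have "N2 \<le> 2 ^ (2 * 2 ^ m) + 2 ^ 2 ^ m * 2 ^ 2 ^ m"
      unfolding N2_def N1_def
    proof (intro add_mono mult_le_mono block_start_le)
      have "power4_sum (H - 1) \<le> 4 ^ Suc (H - 1)" using three_times_power4_sum[of "H - 1"] by simp
      also have "\<dots> = 2 ^ (2 * H)" using H by (simp add: power_mult)
      also have "\<dots> \<le> 2 ^ 2 ^ m" by (rule power_increasing) (auto simp: q)
      finally show "power4_sum (H - 1) \<le> 2 ^ 2 ^ m" .
    qed (auto intro: less_imp_le less_exp)
    also have "\<dots> = 2 ^ (2 * 2 ^ m + 1)" by (simp add: mult_2 power_add)
    also have "\<dots> \<le> 2 ^ (3 * 2 ^ m)" by (rule power_increasing) auto
    finally have N2: "N2 \<le> 2 ^ (3 * 2 ^ m)" .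
    have "(\<Sum>n<N2. hit_error n) - (\<Sum>n<N1. hit_error n) \<ge> (real H)\<^sup>2"
      using hit_error_segment_ge[of a] by (simp add: N2_def sum_lessThan_add N1_def m_def H_def a_def)
    \<comment> \<open>The segment error is a difference of two partial sums, so at least one end
      carries half of it; \<open>N\<close> is taken to be such an end.\<close>
    then have "\<bar>\<Sum>n<N1. hit_error n\<bar> \<ge> (real H)\<^sup>2 / 2 \<or> \<bar>\<Sum>n<N2. hit_error n\<bar> \<ge> (real H)\<^sup>2 / 2"
      by linarith
    then obtain N where N: "N \<in> {N1, N2}" "\<bar>\<Sum>n<N. hit_error n\<bar> \<ge> (real H)\<^sup>2 / 2" by blast
    have NM: "M < N" "N \<le> 2 ^ (3 * 2 ^ m)" using N(1) N1 N2 le by auto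
    have "ln (real N) \<le> ln (real (2 ^ (3 * 2 ^ m)))" using NM by (subst ln_le_cancel_iff) auto
    also have "\<dots> = real (3 * 2 ^ m) * ln 2" by (simp add: ln_realpow)
    also have "\<dots> \<le> real (3 * 2 ^ m) * 1" using ln_le_minus_one[of "2::real"] by (intro mult_left_mono) auto
    also have "\<dots> = 48 * real H" unfolding q by simp
    finally have "(ln (real N))\<^sup>2 \<le> (48 * real H)\<^sup>2" using NM by (intro power_mono) auto
    then have "?c * (ln (real N))\<^sup>2 \<le> (real H)\<^sup>2 / 2" by (simp add: power_mult_distrib)
    also have "\<dots> \<le> real N * ?D N"
      using N(2) sum_hit_error_le_discrepancy[of N] NM by linarith
    finally have "?c * ((ln (real N))\<^sup>2 / real N) \<le> ?D N"
      using NM by (simp add: field_simps)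
    with NM show "\<exists>N>M. N \<in> {N. 1 \<le> N \<and> ?c * ((ln (real N))\<^sup>2 / real N) \<le> ?D N}"
      by (intro exI[of _ N]) auto
  qed
qed

end
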